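(* Let $c:\mathbb{R}^n\to\mathbb{R}$ be convex and continuous, let $s\in\mathbb{R}^n$ satisfy $c(s)<0$, and suppose that $C=\{x\in\mathbb{R}^n:c(x)\le0\}$ is compact (and convex). Let $T:\mathbb{R}^n\to\mathbb{R}^n$ be continuous and monotone. Let $(x^k)$ be a sequence of iterates in $\mathbb{R}^n$. (i) If, for each $x^k$, the oracle returns $$y^k\in\operatorname*{arg\,max}_{y\in C}\langle T(y),x^k-y\rangle,\qquad v^k=T(y^k),$$ with trial point $\widetilde y^k=y^k$ (so that the Slater correction is inactive), then the oracle condition defined in the context holds with $\sigma=1$ and $\varepsilon_k=0$ for all $k$. (ii) If, for each $x^k$, the problem of maximising $\langle T(y),x^k-y\rangle$ over $y\in C$ is solved only up to an additive error $\varepsilon_k\ge0$ with $\varepsilon_k\to0$, i.e. $y^k\in C$, $\langle T(y^k),x^k-y^k\rangle\ge\sup_{y\in C}\langle T(y),x^k-y\rangle-\varepsilon_k$, $v^k=T(y^k)$ and $\widetilde y^k=y^k$, then the oracle condition defined in the context holds with $\sigma=1$ and these errors $\varepsilon_k$.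
   Context: $[t]_+=\max\{t,0\}$. For a single-valued $T$, the Minty gap is $\Phi(x)=\sup_{z\in C}\langle T(z),x-z\rangle$ and $\Phi_+(x)=\max\{\Phi(x),0\}$. Oracle condition with parameters $\sigma\in(0,1]$ and $\varepsilon_k\ge0$, $\varepsilon_k\to0$: for every $x^k$ the oracle returns a trial point $\widetilde y^k$; with $\lambda_k=0$ if $c(\widetilde y^k)\le0$ and $\lambda_k=\frac{c(\widetilde y^k)}{c(\widetilde y^k)-c(s)}$ if $c(\widetilde y^k)>0$, one has $y^k=(1-\lambda_k)\widetilde y^k+\lambda_k s$ (Slater correction), and $v^k=T(y^k)$. Whenever $(x^k)$ is bounded, the sequences $(y^k)$ and $(v^k)$ are bounded and $[\langle v^k,x^k-y^k\rangle]_+\ge\sigma\Phi_+(x^k)-\varepsilon_k$ for all $k$. *)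

theory Defs
  imports "HOL-Analysis.Analysis"
begin

definition monotone_operator :: "('a::real_inner \<Rightarrow> 'a) \<Rightarrow> bool" where
  "monotone_operator T \<longleftrightarrow> (\<forall>x y. (T x - T y) \<bullet> (x - y) \<ge> 0)"

definition feasible_set :: "('a \<Rightarrow> real) \<Rightarrow> 'a set" where
  "feasible_set c = {x. c x \<le> 0}"

text \<open>The supremum is taken in the reals, so it carries its usual meaning only if \<open>C\<close> is
  nonempty and the values are bounded above; this is the case for \<open>C\<close> compact and nonempty and
  \<open>T\<close> continuous.\<close>

definition minty_gap :: "('a::real_inner \<Rightarrow> 'a) \<Rightarrow> 'a set \<Rightarrow> 'a \<Rightarrow> real" where
  "minty_gap T C x = (SUP z\<in>C. T z \<bullet> (x - z))"

definition minty_gap_plus :: "('a::real_inner \<Rightarrow> 'a) \<Rightarrow> 'a set \<Rightarrow> 'a \<Rightarrow> real" where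
  "minty_gap_plus T C x = max (minty_gap T C x) 0"

definition slater_weight :: "('a \<Rightarrow> real) \<Rightarrow> 'a \<Rightarrow> 'a \<Rightarrow> real" where
  "slater_weight c s yt = (if c yt \<le> 0 then 0 else c yt / (c yt - c s))"

definition slater_correction :: "('a::real_vector \<Rightarrow> real) \<Rightarrow> 'a \<Rightarrow> 'a \<Rightarrow> 'a" where
  "slater_correction c s yt =
     (1 - slater_weight c s yt) *\<^sub>R yt + slater_weight c s yt *\<^sub>R s"

text \<open>The arguments \<open>x\<close>, \<open>yt\<close>, \<open>y\<close>, \<open>v\<close> are the sequences of iterates, trial points, corrected
  points and operator values.\<close>

definition oracle_condition ::
  "('a::real_inner \<Rightarrow> 'a) \<Rightarrow> ('a \<Rightarrow> real) \<Rightarrow> 'a \<Rightarrow> real \<Rightarrow> (nat \<Rightarrow> real) \<Rightarrow>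
   (nat \<Rightarrow> 'a) \<Rightarrow> (nat \<Rightarrow> 'a) \<Rightarrow> (nat \<Rightarrow> 'a) \<Rightarrow> (nat \<Rightarrow> 'a) \<Rightarrow> bool" where
  "oracle_condition T c s \<sigma> \<epsilon> x yt y v \<longleftrightarrow>
     0 < \<sigma> \<and> \<sigma> \<le> 1 \<and> (\<forall>k. 0 \<le> \<epsilon> k) \<and> \<epsilon> \<longlonglongrightarrow> 0 \<and>
     (\<forall>k. y k = slater_correction c s (yt k) \<and> v k = T (y k)) \<and>
     (bounded (range x) \<longrightarrow>
        bounded (range y) \<and> bounded (range v) \<and>
        (\<forall>k. max (v k \<bullet> (x k - y k)) 0
              \<ge> \<sigma> * minty_gap_plus T (feasible_set c) (x k) - \<epsilon> k))"

end

theory Submission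
  imports Defs
begin

text \<open>The oracle maximises over C exactly the function whose supremum is the Minty gap at
  \<open>x k\<close>. Hence a maximiser attains the gap, and an approximate one misses it by at most
  \<open>\<epsilon> k\<close>; passing to positive parts preserves this estimate, which gives the
  constant 1. Boundedness comes from compactness: the points \<open>y k\<close> lie in C and the
  values \<open>v k\<close> in the image of C under T, compact by continuity.
  \<open>approximate_maximiser_oracle_condition\<close> carries out this argument, and both claims
  are instances of it; for exact maximisers the error is 0 and \<open>minty_gap_le_arg_max\<close>
  supplies the estimate.\<close>

lemma approximate_maximiser_oracle_condition:
  fixes T :: "'a::euclidean_space \<Rightarrow> 'a"
  assumes compact: "compact (feasible_set c)"
    and cont: "continuous_on (feasible_set c) T"
    and err: "\<And>k. 0 \<le> \<epsilon> k" "\<epsilon> \<longlonglongrightarrow> 0"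
    and feasible: "\<And>k. y k \<in> feasible_set c"
    and approx: "\<And>k. T (y k) \<bullet> (x k - y k) \<ge> minty_gap T (feasible_set c) (x k) - \<epsilon> k"
    and v: "\<And>k. v k = T (y k)"
    and yt: "\<And>k. yt k = y k"
  shows "oracle_condition T c s 1 \<epsilon> x yt y v"
proof -
  \<comment> \<open>Feasibility of the trial point makes the Slater weight 0, so the correction is
    the identity.\<close>
  have "y k = slater_correction c s (yt k)" for k
    using feasible[of k]
    by (simp add: yt feasible_set_def slater_correction_def slater_weight_def)
  moreover have "bounded (range y)"
    using compact_imp_bounded[OF compact] feasible by (auto intro: bounded_subset)
  moreover have "bounded (range v)"
    using compact_imp_bounded[OF compact_continuous_image[OF cont compact]] feasible v
    by (auto intro: bounded_subset)
  \<comment> \<open>If the gap is nonnegative, this follows from \<open>approx\<close>; if it is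
    negative, the right side is \<open>- \<epsilon> k\<close>, which is at most 0.\<close>
  moreover have "max (v k \<bullet> (x k - y k)) 0 \<ge> 1 * minty_gap_plus T (feasible_set c) (x k) - \<epsilon> k"
    for k
    using approx[of k] err(1)[of k] by (auto simp: v minty_gap_plus_def)
  ultimately show ?thesis
    using err v by (simp add: oracle_condition_def)
qed

text \<open>The value at a maximiser is an upper bound for the family, and the maximiser itself
  shows that C is nonempty, so the real supremum is not a default value and lies below this
  bound.\<close>

lemma minty_gap_le_arg_max:
  assumes "is_arg_max (\<lambda>w. T w \<bullet> (x - w)) (\<lambda>w. w \<in> C) y"
  shows "minty_gap T C x \<le> T y \<bullet> (x - y)"
  unfolding minty_gap_def
  by (rule cSUP_least) (use assms in \<open>auto simp: is_arg_max_linorder\<close>)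

theorem proposition6p2:
  fixes c :: "real ^ 'n \<Rightarrow> real"
    and s :: "real ^ 'n"
    and T :: "real ^ 'n \<Rightarrow> real ^ 'n"
    and C :: "(real ^ 'n) set"
    and x :: "nat \<Rightarrow> real ^ 'n"
  assumes "convex_on UNIV c" and "continuous_on UNIV c"
    and "c s < 0"
    and C_def: "C = feasible_set c"
    and "compact C" and "convex C"
    and "continuous_on UNIV T" and "monotone_operator T"
  shows
    "(\<forall>yt y v :: nat \<Rightarrow> real ^ 'n.
        (\<forall>k. is_arg_max (\<lambda>w. T w \<bullet> (x k - w)) (\<lambda>w. w \<in> C) (y k)
           \<and> v k = T (y k) \<and> yt k = y k)
        \<longrightarrow> oracle_condition T c s 1 (\<lambda>k. 0) x yt y v)
     \<and>
     (\<forall>(\<epsilon> :: nat \<Rightarrow> real) (yt :: nat \<Rightarrow> real ^ 'n) y v.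
        (\<forall>k. 0 \<le> \<epsilon> k) \<and> \<epsilon> \<longlonglongrightarrow> 0
        \<and> (\<forall>k. y k \<in> C
             \<and> T (y k) \<bullet> (x k - y k) \<ge> (SUP w\<in>C. T w \<bullet> (x k - w)) - \<epsilon> k
             \<and> v k = T (y k) \<and> yt k = y k)
        \<longrightarrow> oracle_condition T c s 1 \<epsilon> x yt y v)"
proof -
  have comp: "compact (feasible_set c)" and cont: "continuous_on (feasible_set c) T"
    using assms by (auto intro: continuous_on_subset)
  show ?thesis
  proof (intro conjI allI impI)
    fix yt y v :: "nat \<Rightarrow> real ^ 'n"
    assume *: "\<forall>k. is_arg_max (\<lambda>w. T w \<bullet> (x k - w)) (\<lambda>w. w \<in> C) (y k)
           \<and> v k = T (y k) \<and> yt k = y k"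
    have "y k \<in> feasible_set c" for k
      using * by (simp add: C_def is_arg_max_def)
    moreover have "minty_gap T (feasible_set c) (x k) \<le> T (y k) \<bullet> (x k - y k)" for k
      using * minty_gap_le_arg_max unfolding C_def by blast
    \<comment> \<open>Exact maximisation is the case of zero error.\<close>
    ultimately show "oracle_condition T c s 1 (\<lambda>k. 0) x yt y v"
      using * by (intro approximate_maximiser_oracle_condition comp cont) auto
  next
    fix \<epsilon> :: "nat \<Rightarrow> real" and yt y v :: "nat \<Rightarrow> real ^ 'n"
    assume "(\<forall>k. 0 \<le> \<epsilon> k) \<and> \<epsilon> \<longlonglongrightarrow> 0
        \<and> (\<forall>k. y k \<in> C
             \<and> T (y k) \<bullet> (x k - y k) \<ge> (SUP w\<in>C. T w \<bullet> (x k - w)) - \<epsilon> k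
             \<and> v k = T (y k) \<and> yt k = y k)"
    \<comment> \<open>The supremum in the assumption is \<open>minty_gap\<close> unfolded, so the
      approximate optimality is already in the required form.\<close>
    then show "oracle_condition T c s 1 \<epsilon> x yt y v"
      by (intro approximate_maximiser_oracle_condition comp cont)
        (auto simp: C_def minty_gap_def)
  qed
qed

end
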